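(* Let the setting be as in the context, with $0<\sigma<\infty$. Assume $\Lambda<\infty$ and let $u$ be a weak solution of $$-\sum_{p=2}^\infty a_p\Delta_pu=f\ \text{ in }\Omega,\qquad u=g\ \text{ on }\partial\Omega,$$ with $f\in L^1(\Omega)$ and $g\in C^{0,1}(\partial\Omega)$. Then $$\Big|\int_Ef\Big|\ \le\ \Lambda\,P(E)\qquad\text{for every set of finite perimeter }E\Subset\Omega .$$
   Context: $\Omega\subset\mathbb{R}^N$ ($N\ge1$) is a bounded, connected, open set with Lipschitz boundary. $\{a_p\}_{p\ge2}$ ($p$ integer) is a real sequence with $a_p\ge0$ for all $p$, $a_2>0$, and $a_p\ne0$ for infinitely many $p$; $\sigma$ is defined by $1/\sigma=\limsup_{p\to\infty}a_p^{1/p}$, and $\Lambda=\sum_{p\ge2}a_p\sigma^{p-1}\in(0,+\infty]$. $S_g=\{v\in C^{0,1}(\overline\Omega):\ \|\nabla v\|_{L^\infty(\Omega)}\le\sigma,\ v=g\text{ on }\partial\Omega\}$. $P(E)$ is the perimeter of $E$ in $\mathbb{R}^N$. Here $\Delta_pu=\operatorname{div}(|\nabla u|^{p-2}\nabla u)$. A function $u\in S_g$ is a weak solution of the Dirichlet problem if $\sum_{p=2}^{\infty}a_p\int_\Omega|\nabla u|^{p-2}\nabla u\cdot\nabla\psi=\int_\Omega f\psi$ for every $\psi\in W^{1,\infty}_0(\Omega)$ (Lipschitz functions on $\overline\Omega$ vanishing on $\partial\Omega$) for which the series on the left is absolutely convergent, i.e. $\sum_pa_p\big|\int_\Omega|\nabla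 u|^{p-2}\nabla u\cdot\nabla\psi\big|<\infty$ (when $\Lambda<\infty$ this holds for every such $\psi$). *)

theory Defs
  imports "HOL-Analysis.Analysis"
begin

text \<open>
  Near each boundary point, in suitable orthonormal coordinates with last axis \<open>e\<close>, the set is
  the strict epigraph of a Lipschitz function on the hyperplane orthogonal to \<open>e\<close>.
\<close>

definition lipschitz_boundary :: "'a::euclidean_space set \<Rightarrow> bool" where
  "lipschitz_boundary \<Omega> \<longleftrightarrow>
     (\<forall>z\<in>frontier \<Omega>. \<exists>r>0. \<exists>e h L. norm e = 1 \<and> L-lipschitz_on {y. y \<bullet> e = 0} h \<and>
        \<Omega> \<inter> ball z r = {y \<in> ball z r. (h (y - (y \<bullet> e) *\<^sub>R e) :: real) < y \<bullet> e})"

text \<open>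
  The pointwise gradient. For a Lipschitz function on an open set it exists almost everywhere
  (Rademacher) and agrees there with the weak gradient; it is unspecified at the other points.
\<close>

definition grad :: "('a::euclidean_space \<Rightarrow> real) \<Rightarrow> 'a \<Rightarrow> 'a" where
  "grad u x = (THE D. GDERIV u x :> D)"

definition divergence :: "('a::euclidean_space \<Rightarrow> 'a) \<Rightarrow> 'a \<Rightarrow> real" where
  "divergence \<phi> x = (\<Sum>b\<in>Basis. frechet_derivative \<phi> (at x) b \<bullet> b)"

definition C1_compact_support :: "('a::euclidean_space \<Rightarrow> 'a) \<Rightarrow> bool" where
  "C1_compact_support \<phi> \<longleftrightarrow>
     (\<exists>\<phi>' :: 'a \<Rightarrow> 'a \<Rightarrow>\<^sub>L 'a. (\<forall>x. (\<phi> has_derivative blinfun_apply (\<phi>' x)) (at x)) \<and>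
        continuous_on UNIV \<phi>') \<and>
     compact (closure {x. \<phi> x \<noteq> 0})"

text \<open>
  De Giorgi's perimeter in the whole space. The truncation of negative values by \<^const>\<open>ennreal\<close> is
  harmless, since the zero field is admissible.
\<close>

definition perimeter :: "'a::euclidean_space set \<Rightarrow> ennreal" where
  "perimeter E =
     (SUP \<phi>\<in>{\<phi>. C1_compact_support \<phi> \<and> (\<forall>x. norm (\<phi> x) \<le> 1)}.
        ennreal (LINT x:E|lebesgue. divergence \<phi> x))"

definition finite_perimeter :: "'a::euclidean_space set \<Rightarrow> bool" where
  "finite_perimeter E \<longleftrightarrow> E \<in> sets lebesgue \<and> perimeter E < \<infinity>"

definition compactly_contained :: "'a::euclidean_space set \<Rightarrow> 'a set \<Rightarrow> bool" where
  "compactly_contained E \<Omega> \<longleftrightarrow> compact (closure E) \<and> closure E \<subseteq> \<Omega>"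

text \<open>
  The space $C^{0,1}(A)$. Functions on \<open>A\<close> are represented by total functions whose values
  outside \<open>A\<close> are irrelevant.
\<close>

definition C01 :: "'a::euclidean_space set \<Rightarrow> ('a \<Rightarrow> real) set" where
  "C01 A = {v. \<exists>L. L-lipschitz_on A v}"

definition S_class :: "'a::euclidean_space set \<Rightarrow> real \<Rightarrow> ('a \<Rightarrow> real) \<Rightarrow> ('a \<Rightarrow> real) set" where
  "S_class \<Omega> \<sigma> g =
     {v \<in> C01 (closure \<Omega>). (AE x in lebesgue_on \<Omega>. norm (grad v x) \<le> \<sigma>) \<and>
        (\<forall>x\<in>frontier \<Omega>. v x = g x)}"

definition W0_1_inf :: "'a::euclidean_space set \<Rightarrow> ('a \<Rightarrow> real) set" where
  "W0_1_inf \<Omega> = {\<psi> \<in> C01 (closure \<Omega>). \<forall>x\<in>frontier \<Omega>. \<psi> x = 0}"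

definition p_form :: "'a::euclidean_space set \<Rightarrow> nat \<Rightarrow> ('a \<Rightarrow> real) \<Rightarrow> ('a \<Rightarrow> real) \<Rightarrow> real" where
  "p_form \<Omega> p u \<psi> =
     (LINT x:\<Omega>|lebesgue. (norm (grad u x) ^ (p - 2) *\<^sub>R grad u x) \<bullet> grad \<psi> x)"

definition weak_solution ::
  "'a::euclidean_space set \<Rightarrow> (nat \<Rightarrow> real) \<Rightarrow> real \<Rightarrow> ('a \<Rightarrow> real) \<Rightarrow> ('a \<Rightarrow> real) \<Rightarrow> ('a \<Rightarrow> real) \<Rightarrow> bool"
where
  "weak_solution \<Omega> a \<sigma> f g u \<longleftrightarrow>
     u \<in> S_class \<Omega> \<sigma> g \<and>
     (\<forall>\<psi>\<in>W0_1_inf \<Omega>. (\<lambda>p. a p * \<bar>p_form \<Omega> p u \<psi>\<bar>) summable_on {2..} \<longrightarrow>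
        (\<Sum>\<^sub>\<infinity>p\<in>{2..}. a p * p_form \<Omega> p u \<psi>) = (LINT x:\<Omega>|lebesgue. f x * \<psi> x))"

definition Lambda :: "(nat \<Rightarrow> real) \<Rightarrow> real \<Rightarrow> ennreal" where
  "Lambda a \<sigma> = (\<Sum>\<^sub>\<infinity>p\<in>{2..}. ennreal (a p * \<sigma> ^ (p - 1)))"

end

theory Submission
  imports Defs
begin

text \<open>
  Test the equation with a mollification \<open>\<psi>\<close> of the indicator function of \<open>E\<close>. The pointwise bound
  on \<open>grad u\<close> gives \<open>\<bar>\<integral> f \<psi>\<bar> \<le> \<Lambda> \<integral> \<bar>grad \<psi>\<bar>\<close>, mollification does not increase the total
  variation, so that \<open>\<integral> \<bar>grad \<psi>\<bar> \<le> P(E)\<close>, and \<open>\<psi>\<close> converges to the indicator in \<open>L\<^sup>1\<close>, hence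
  almost everywhere along a subsequence, while staying bounded by 1. Kernels of class \<open>C\<^sup>1\<close> with
  Lipschitz gradient suffice: differentiation under the integral sign is then immediate
  from the quadratic Taylor remainder.
\<close>

subsection \<open>Mollifiers\<close>

text \<open>The factor in front of P(E) is exactly 1 because of duality: the L1 norm of the gradient
  of the mollified indicator is attained against minus its sign. That field is discontinuous, but
  mollifying it gives an admissible C1 field that still has norm at most 1. Convergence in L1 is
  made quantitative by squeezing \<open>E\<close> between a closed set \<open>C\<close> and an open
  set \<open>U\<close> of almost the same measure: mollification at a radius below the distance from
  \<open>C\<close> to the complement of \<open>U\<close> changes the indicator only at the cost of
  \<open>U - C\<close>. Compact containment leaves a second margin, which makes the test function
  vanish off \<open>\<Omega>\<close>. Fubini is applied on the product of Borel measures, so the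
  argument runs for Borel \<open>E\<close>. A Lebesgue measurable set is a Borel set up to a null
  set, and neither the perimeter nor the integral of \<open>f\<close> sees the difference.
  Finiteness of \<open>Lambda\<close> serves twice: the same domination of the series makes each
  test function admissible and yields the estimate.\<close>

lemma has_derivative_quadratic_remainder:
  fixes f :: "'a::real_normed_vector \<Rightarrow> 'b::real_normed_vector"
  assumes "bounded_linear D" and rem: "\<And>h. norm (f (x + h) - f x - D h) \<le> C * (norm h)\<^sup>2"
  shows "(f has_derivative D) (at x)"
  unfolding has_derivative_at
proof (rule conjI[OF assms(1)], rule Lim_null_comparison)
  have "norm (f (x + h) - f x - D h) / norm h \<le> C * norm h" for h
  proof (cases "h = 0")
    case False
    then show ?thesis
      using rem[of h] by (simp only: divide_le_eq power2_eq_square mult.assoc zero_less_norm_iff) simp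
  qed simp
  then show "\<forall>\<^sub>F h in at 0. norm (norm (f (x + h) - f x - D h) / norm h) \<le> C * norm h"
    by simp
  show "((\<lambda>h. C * norm h) \<longlongrightarrow> 0) (at 0)"
    by (intro tendsto_mult_right_zero tendsto_norm_zero tendsto_ident_at)
qed

text \<open>\<open>K\<close> is the gradient of \<open>k\<close>, carried as an explicit field so
  that derivatives of convolutions become integrals against \<open>K\<close>. One constant
  \<open>M\<close> bounds \<open>k\<close>, \<open>K\<close> and the Lipschitz constant of
  \<open>K\<close>; its dependence on \<open>r\<close> is harmless, since \<open>M\<close> never
  enters the final estimate.\<close>

locale mollifier =
  fixes r :: real and k :: "'a::euclidean_space \<Rightarrow> real" and K :: "'a \<Rightarrow> 'a" and M :: real
  assumes nonneg: "0 \<le> k x"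
    and support: "r \<le> norm x \<Longrightarrow> k x = 0" and grad_support: "r \<le> norm x \<Longrightarrow> K x = 0"
    and deriv: "(k has_derivative (\<lambda>h. K x \<bullet> h)) (at x)"
    and bounded: "k x \<le> M" and grad_bounded: "norm (K x) \<le> M"
    and grad_lipschitz: "norm (K x - K y) \<le> M * norm (x - y)"
    and even: "k (- x) = k x" and grad_odd: "K (- x) = - K x"
    and integral_eq_1: "(\<integral>x. k x \<partial>lborel) = 1"

text \<open>Squaring removes the kink of the positive part at 0: the remainder stays below h^2 even
  when \<open>t\<close> and \<open>t + h\<close> lie on opposite sides of it.\<close>

lemma squared_pos_part_DERIV:
  "((\<lambda>t::real. (max 0 t)\<^sup>2) has_field_derivative 2 * max 0 t) (at t)"
proof -
  have "norm ((max 0 (t + h))\<^sup>2 - (max 0 t)\<^sup>2 - 2 * max 0 t * h) \<le> 1 * (norm h)\<^sup>2" for h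
  proof (cases "t \<ge> 0"; cases "t + h \<ge> 0")
    assume "t \<ge> 0" "\<not> t + h \<ge> 0"
    then have "0 \<le> -h - t" "0 \<le> t" "0 \<le> -h" by auto
    then have "t * t \<le> t * (-h)" "t * (-h) \<le> (-h) * (-h)"
      by (intro mult_left_mono mult_right_mono; linarith)+
    moreover have "t * h \<le> 0" using \<open>0 \<le> t\<close> \<open>0 \<le> -h\<close> by (auto intro: mult_nonneg_nonpos)
    moreover have "0 \<le> h * h" by simp
    moreover have "0 \<le> (h + t) * (h + t)" by simp
    ultimately show ?thesis using \<open>t \<ge> 0\<close> \<open>\<not> t + h \<ge> 0\<close>
      by (simp add: max_def power2_eq_square abs_le_iff algebra_simps)
  next
    assume "\<not> t \<ge> 0" "t + h \<ge> 0"
    then show ?thesis using power_mono[of "t + h" h 2] by (simp add: max_def)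
  qed (auto simp: max_def power2_eq_square algebra_simps)
  then show ?thesis
    unfolding has_field_derivative_def
    by (rule has_derivative_quadratic_remainder[OF bounded_linear_mult_right])
qed

text \<open>Up to a scalar this field is the gradient of the kernel built below. The constant is 2 r
  * r from the variation of the positive part plus r^2 from its maximum.\<close>

lemma pos_part_scaleR_lipschitz:
  fixes x y :: "'a::real_inner"
  assumes "r > 0"
  shows "norm (max 0 (r\<^sup>2 - (norm x)\<^sup>2) *\<^sub>R x - max 0 (r\<^sup>2 - (norm y)\<^sup>2) *\<^sub>R y) \<le> 3 * r\<^sup>2 * norm (x - y)"
proof -
  let ?q = "\<lambda>x::'a. max 0 (r\<^sup>2 - (norm x)\<^sup>2)"
  \<comment> \<open>By symmetry \<open>x\<close> may be taken as the point nearer to the origin. If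
    it lies outside the ball, both terms vanish; otherwise its norm is at most \<open>r\<close>,
    which controls the factor next to the difference of the \<open>?q\<close> values.\<close>
  have *: "norm (?q x *\<^sub>R x - ?q y *\<^sub>R y) \<le> 3 * r\<^sup>2 * norm (x - y)" if le: "norm x \<le> norm y" for x y :: 'a
  proof (cases "norm x \<le> r")
    case False
    then have "r\<^sup>2 \<le> (norm x)\<^sup>2" "r\<^sup>2 \<le> (norm y)\<^sup>2"
      using le assms by (auto intro!: power_mono)
    then show ?thesis by (simp add: max_def)
  next
    case True
    have qy: "?q y \<le> r\<^sup>2" "0 \<le> ?q y" by auto
    have d: "norm y - norm x \<le> norm (x - y)"
      by (metis norm_minus_commute norm_triangle_ineq2)
    have qd: "\<bar>?q x - ?q y\<bar> \<le> 2 * r * norm (x - y)"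
    proof (cases "norm y \<le> r")
      case True
      have "(norm x)\<^sup>2 \<le> r\<^sup>2" "(norm y)\<^sup>2 \<le> r\<^sup>2" using True \<open>norm x \<le> r\<close> by (auto intro!: power_mono)
      moreover have "(norm x)\<^sup>2 \<le> (norm y)\<^sup>2" using le by (auto intro!: power_mono)
      ultimately have "\<bar>?q x - ?q y\<bar> = (norm y + norm x) * (norm y - norm x)"
        by (simp add: max_def power2_eq_square algebra_simps)
      also have "\<dots> \<le> (2 * r) * norm (x - y)"
        using le d True \<open>norm x \<le> r\<close> assms by (intro mult_mono) auto
      finally show ?thesis .
    next
      case False
      have "(norm x)\<^sup>2 \<le> r\<^sup>2" "(norm y)\<^sup>2 \<ge> r\<^sup>2" using False \<open>norm x \<le> r\<close> assms by (auto intro!: power_mono)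
      then have "\<bar>?q x - ?q y\<bar> = (r + norm x) * (r - norm x)"
        by (simp add: max_def power2_eq_square algebra_simps)
      also have "\<dots> \<le> (2 * r) * norm (x - y)"
        using le d False \<open>norm x \<le> r\<close> assms by (intro mult_mono) auto
      finally show ?thesis .
    qed
    have "?q x *\<^sub>R x - ?q y *\<^sub>R y = (?q x - ?q y) *\<^sub>R x + ?q y *\<^sub>R (x - y)"
      by (simp add: algebra_simps)
    also have "norm \<dots> \<le> \<bar>?q x - ?q y\<bar> * norm x + ?q y * norm (x - y)"
      using qy by (intro norm_triangle_le) auto
    also have "\<dots> \<le> (2 * r * norm (x - y)) * r + r\<^sup>2 * norm (x - y)"
      using qd qy True assms by (intro add_mono mult_mono) auto
    finally show ?thesis by (simp add: power2_eq_square algebra_simps)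
  qed
  show ?thesis
    using *[of x y] *[of y x] by (metis linear norm_minus_commute)
qed

lemma mollifier_exists:
  assumes "r > 0"
  shows "\<exists>(k :: 'a::euclidean_space \<Rightarrow> real) K M. mollifier r k K M"
proof -
  \<comment> \<open>The kernel is a multiple of \<open>(max 0 (r\<^sup>2 - \<bar>x\<bar>\<^sup>2))\<^sup>2\<close>.\<close>
  define q where "q x = max 0 (r\<^sup>2 - (norm x)\<^sup>2)" for x :: 'a
  define b where "b x = (q x)\<^sup>2" for x :: 'a
  have q: "0 \<le> q x" "q x \<le> r\<^sup>2" for x by (auto simp: q_def)
  have q0: "q x = 0" if "r \<le> norm x" for x
    using that assms power_mono[of r "norm x" 2] by (auto simp: q_def)
  have b: "0 \<le> b x" "b x \<le> r ^ 4" for x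
    using power_mono[OF q(2)[of x] q(1)[of x], of 2] by (auto simp: b_def simp flip: power_mult)
  have deriv_b: "(b has_derivative (\<lambda>h. ((-4 * q x) *\<^sub>R x) \<bullet> h)) (at x)" for x
  proof -
    have "((\<lambda>x::'a. r\<^sup>2 - x \<bullet> x) has_derivative (\<lambda>h. -2 * (x \<bullet> h))) (at x)"
      by (auto intro!: derivative_eq_intros simp: inner_commute)
    from has_derivative_compose[OF this, of "\<lambda>t. (max 0 t)\<^sup>2" "(*) (2 * max 0 (r\<^sup>2 - x \<bullet> x))"]
      squared_pos_part_DERIV[of "r\<^sup>2 - x \<bullet> x"]
    show ?thesis
      by (simp add: b_def[abs_def] q_def[abs_def] power2_norm_eq_inner has_field_derivative_def
          algebra_simps)
  qed
  then have cont: "continuous_on UNIV b"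
    by (meson continuous_at_imp_continuous_on has_derivative_continuous)
  then have [measurable]: "b \<in> borel_measurable borel"
    by (rule borel_measurable_continuous_onI)
  have int: "integrable lborel b"
  proof (rule Bochner_Integration.integrable_bound)
    show "integrable lborel (\<lambda>x::'a. r ^ 4 * indicator (ball 0 r) x :: real)"
      using emeasure_lborel_ball_finite[of "0::'a" r] by (intro integrable_mult_right) auto
    show "AE x in lborel. norm (b x) \<le> norm (r ^ 4 * indicator (ball 0 r) x :: real)"
      using b q0 by (auto simp: indicator_def b_def)
  qed auto
  define c where "c = (\<integral>x. b x \<partial>lborel)"
  \<comment> \<open>On the ball of radius \<open>r/2\<close> the function \<open>q\<close> is at
    least r^2 - (r/2)^2 = 3 r^2 / 4. This keeps the normalising constant \<open>c\<close> away from
    0.\<close>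
  have "0 < (3 * r\<^sup>2 / 4)\<^sup>2 * measure lborel (ball (0::'a) (r/2))"
    using assms by (intro mult_pos_pos) (auto simp: content_ball_pos)
  also have "\<dots> = (\<integral>x. (3 * r\<^sup>2 / 4)\<^sup>2 * indicator (ball (0::'a) (r/2)) x \<partial>lborel)"
    by simp
  also have "\<dots> \<le> c"
    unfolding c_def
  proof (rule integral_mono[OF _ int])
    show "integrable lborel (\<lambda>x::'a. (3 * r\<^sup>2 / 4)\<^sup>2 * indicator (ball 0 (r/2)) x :: real)"
      using emeasure_lborel_ball_finite[of "0::'a" "r/2"] by (intro integrable_mult_right) auto
    fix x :: 'a
    show "(3 * r\<^sup>2 / 4)\<^sup>2 * indicator (ball 0 (r/2)) x \<le> b x"
    proof (cases "norm x < r/2")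
      case True
      then have "(norm x)\<^sup>2 \<le> (r/2)\<^sup>2" by (intro power_mono) auto
      then have "3 * r\<^sup>2 / 4 \<le> r\<^sup>2 - (norm x)\<^sup>2" by (simp add: power_divide)
      then have "3 * r\<^sup>2 / 4 \<le> q x" unfolding q_def by (rule max.coboundedI2)
      then have "(3 * r\<^sup>2 / 4)\<^sup>2 \<le> (q x)\<^sup>2" by (rule power_mono) simp
      then show ?thesis by (simp add: b_def indicator_def)
    qed (use b in auto)
  qed
  finally have c: "c > 0" .
  \<comment> \<open>The three entries bound, in turn, the kernel (r^4), its gradient (4 * r^2 * r)
    and the Lipschitz constant of the gradient (4 * 3 r^2), each divided by
    \<open>c\<close>.\<close>
  define M where "M = max (r ^ 4 / c) (max (4 * r ^ 3 / c) (12 * r\<^sup>2 / c))"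
  have "mollifier r (\<lambda>x. b x / c) (\<lambda>x. (-4 / c * q x) *\<^sub>R x) M"
  proof
    fix x y :: 'a
    show "0 \<le> b x / c" using b c by simp
    show "b x / c = 0" if "r \<le> norm x" using q0[OF that] by (simp add: b_def)
    show "(-4 / c * q x) *\<^sub>R x = 0" if "r \<le> norm x" using q0[OF that] by simp
    show "((\<lambda>x. b x / c) has_derivative (\<lambda>h. ((-4 / c * q x) *\<^sub>R x) \<bullet> h)) (at x)"
      by (rule has_derivative_eq_rhs[OF bounded_linear.has_derivative[OF bounded_linear_divide deriv_b]])
        (simp add: fun_eq_iff)
    have "b x / c \<le> r ^ 4 / c" using b c by (intro divide_right_mono) auto
    then show "b x / c \<le> M" by (simp add: M_def)
    have "norm ((-4 / c * q x) *\<^sub>R x) = 4 / c * (q x * norm x)"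
      using c q by (simp add: abs_mult)
    also have "\<dots> \<le> 4 / c * (r\<^sup>2 * r)"
    proof (rule mult_left_mono)
      show "q x * norm x \<le> r\<^sup>2 * r"
      proof (cases "norm x \<le> r")
        case True
        then show ?thesis using q[of x] by (intro mult_mono) auto
      qed (use q0[of x] assms in simp)
    qed (use c in simp)
    also have "\<dots> \<le> M" by (simp add: M_def power2_eq_square power3_eq_cube)
    finally show "norm ((-4 / c * q x) *\<^sub>R x) \<le> M" .
    have "(-4 / c * q x) *\<^sub>R x - (-4 / c * q y) *\<^sub>R y = (-4 / c) *\<^sub>R (q x *\<^sub>R x - q y *\<^sub>R y)"
      by (simp add: scaleR_diff_right)
    also have "norm \<dots> = 4 / c * norm (q x *\<^sub>R x - q y *\<^sub>R y)"
      using c by simp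
    also have "\<dots> \<le> 4 / c * (3 * r\<^sup>2 * norm (x - y))"
      using pos_part_scaleR_lipschitz[OF assms, of x y] c by (intro mult_left_mono) (auto simp: q_def)
    also have "\<dots> = 12 * r\<^sup>2 / c * norm (x - y)" by simp
    also have "\<dots> \<le> M * norm (x - y)"
      by (intro mult_right_mono) (auto simp: M_def)
    finally show "norm ((-4 / c * q x) *\<^sub>R x - (-4 / c * q y) *\<^sub>R y) \<le> M * norm (x - y)" .
    show "b (- x) / c = b x / c" by (simp add: b_def q_def)
    show "(-4 / c * q (- x)) *\<^sub>R (- x) = - ((-4 / c * q x) *\<^sub>R x)" by (simp add: q_def)
    show "(\<integral>x. b x / c \<partial>lborel) = 1" using c by (simp add: c_def)
  qed
  then show ?thesis by blast
qed

section \<open>Convolution with the kernel\<close>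

context mollifier
begin

text \<open>The values lie in an arbitrary Euclidean space because both the indicator of a set and
  the vector fields tested in the perimeter are mollified.\<close>

definition conv :: "('a \<Rightarrow> 'b::euclidean_space) \<Rightarrow> 'a \<Rightarrow> 'b" where
  "conv w x = (\<integral>y. k (x - y) *\<^sub>R w y \<partial>lborel)"

lemma M_nonneg: "0 \<le> M"
  using grad_bounded norm_ge_zero order_trans by blast

lemma continuous_kernel: "continuous_on A k"
  by (meson continuous_at_imp_continuous_on deriv has_derivative_continuous)

lemma continuous_grad: "continuous_on A K"
proof -
  have "M-lipschitz_on A K"
    by (intro lipschitz_onI) (auto simp: dist_norm grad_lipschitz M_nonneg)
  then show ?thesis by (rule lipschitz_on_continuous_on)
qed

lemma kernel_measurable [measurable]: "k \<in> borel_measurable borel" "K \<in> borel_measurable borel"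
  using continuous_kernel continuous_grad by (auto intro: borel_measurable_continuous_onI)

text \<open>The Bochner integral of a non-integrable function is 0, so the normalisation to 1
  already forces integrability.\<close>

lemma kernel_integrable: "integrable lborel k"
  using integral_eq_1 not_integrable_integral_eq by fastforce

lemma kernel_translate:
  "has_bochner_integral lborel (\<lambda>y. k (y - x)) 1"
  "has_bochner_integral lborel (\<lambda>y. k (x - y)) 1"
proof -
  have 1: "has_bochner_integral (distr lborel borel ((+) (- x))) k 1"
    unfolding lborel_distr_plus by (simp add: has_bochner_integral_iff kernel_integrable integral_eq_1)
  show *: "has_bochner_integral lborel (\<lambda>y. k (y - x)) 1"
    using 1 by (simp add: has_bochner_integral_iff integrable_distr_eq integral_distr)
  have "k (x - y) = k (y - x)" for y
    using even[of "x - y"] by simp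
  with * show "has_bochner_integral lborel (\<lambda>y. k (x - y)) 1"
    by simp
qed

text \<open>On the ball of radius \<open>norm h\<close> about \<open>x\<close> the gradient differs
  from \<open>K x\<close> by at most \<open>M * norm h\<close>; the mean value inequality
  contributes the second factor \<open>norm h\<close>.\<close>

lemma taylor: "\<bar>k (x + h) - k x - K x \<bullet> h\<bar> \<le> M * (norm h)\<^sup>2"
proof -
  have "norm (k (x + h) - k x - K x \<bullet> (x + h - x)) \<le> norm (x + h - x) * (M * norm h)"
  proof (rule differentiable_bound_linearization[where S = "cball x (norm h)" and f' = "\<lambda>x h. K x \<bullet> h"])
    show "x + t *\<^sub>R (x + h - x) \<in> cball x (norm h)" if "t \<in> {0..1}" for t
      using that by (auto simp: dist_norm mult_left_le_one_le)
    show "(k has_derivative (\<bullet>) (K z)) (at z within cball x (norm h))" for z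
      using deriv by (rule has_derivative_at_withinI)
    show "onorm ((\<bullet>) (K z) - (\<bullet>) (K x)) \<le> M * norm h" if z: "z \<in> cball x (norm h)" for z
    proof (rule onorm_bound)
      fix v
      have "norm (((\<bullet>) (K z) - (\<bullet>) (K x)) v) \<le> norm (K z - K x) * norm v"
        by (simp flip: inner_diff_left add: Cauchy_Schwarz_ineq2)
      also have "\<dots> \<le> (M * norm (z - x)) * norm v"
        by (intro mult_right_mono grad_lipschitz) auto
      also have "\<dots> \<le> (M * norm h) * norm v"
        using z M_nonneg by (intro mult_right_mono mult_left_mono) (auto simp: dist_norm norm_minus_commute)
      finally show "norm (((\<bullet>) (K z) - (\<bullet>) (K x)) v) \<le> (M * norm h) * norm v" .
    qed (use M_nonneg in auto)
  qed auto
  then show ?thesis by (simp add: power2_eq_square mult_ac)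
qed

context
  fixes w :: "'a \<Rightarrow> 'b::euclidean_space"
  assumes w: "integrable lborel w"
begin

lemma conv_integrable: "integrable lborel (\<lambda>y. k (x - y) *\<^sub>R w y)"
proof (rule Bochner_Integration.integrable_bound)
  show "integrable lborel (\<lambda>y. M *\<^sub>R w y)" using w by simp
  show "(\<lambda>y. k (x - y) *\<^sub>R w y) \<in> borel_measurable lborel" using w by measurable
  show "AE y in lborel. norm (k (x - y) *\<^sub>R w y) \<le> norm (M *\<^sub>R w y)"
    using bounded nonneg M_nonneg by (auto intro!: mult_right_mono)
qed

lemma conv_grad_integrable: "integrable lborel (\<lambda>y. (K (x - y) \<bullet> h) *\<^sub>R w y)"
proof (rule Bochner_Integration.integrable_bound)
  show "integrable lborel (\<lambda>y. (M * norm h) *\<^sub>R w y)" using w by simp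
  show "(\<lambda>y. (K (x - y) \<bullet> h) *\<^sub>R w y) \<in> borel_measurable lborel" using w by measurable
  show "AE y in lborel. norm ((K (x - y) \<bullet> h) *\<^sub>R w y) \<le> norm ((M * norm h) *\<^sub>R w y)"
  proof (intro AE_I2)
    fix y
    have "\<bar>K (x - y) \<bullet> h\<bar> \<le> norm (K (x - y)) * norm h" by (rule Cauchy_Schwarz_ineq2)
    also have "\<dots> \<le> M * norm h" by (intro mult_right_mono grad_bounded) auto
    finally show "norm ((K (x - y) \<bullet> h) *\<^sub>R w y) \<le> norm ((M * norm h) *\<^sub>R w y)"
      using M_nonneg by (auto simp: abs_mult intro!: mult_right_mono)
  qed
qed

lemma conv_grad_bounded:
  "norm (\<integral>y. (K (x - y) \<bullet> h) *\<^sub>R w y \<partial>lborel) \<le> M * (\<integral>y. norm (w y) \<partial>lborel) * norm h"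
proof -
  have "norm (\<integral>y. (K (x - y) \<bullet> h) *\<^sub>R w y \<partial>lborel) \<le> (\<integral>y. (M * norm h) * norm (w y) \<partial>lborel)"
  proof (intro order_trans[OF integral_norm_bound] integral_mono integrable_norm conv_grad_integrable)
    fix y
    have "\<bar>K (x - y) \<bullet> h\<bar> \<le> norm (K (x - y)) * norm h" by (rule Cauchy_Schwarz_ineq2)
    also have "\<dots> \<le> M * norm h" by (intro mult_right_mono grad_bounded) auto
    finally show "norm ((K (x - y) \<bullet> h) *\<^sub>R w y) \<le> (M * norm h) * norm (w y)"
      by (auto intro!: mult_right_mono)
  qed (use w in simp)
  also have "\<dots> = M * (\<integral>y. norm (w y) \<partial>lborel) * norm h"
    by simp
  finally show ?thesis .
qed

lemma conv_grad_linear: "bounded_linear (\<lambda>h. \<integral>y. (K (x - y) \<bullet> h) *\<^sub>R w y \<partial>lborel)"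
proof (rule bounded_linear_intro)
  show "norm (\<integral>y. (K (x - y) \<bullet> h) *\<^sub>R w y \<partial>lborel) \<le> norm h * (M * (\<integral>y. norm (w y) \<partial>lborel))" for h
    using conv_grad_bounded[of x h] by (subst mult.commute)
  show "(\<integral>y. (K (x - y) \<bullet> (h + h')) *\<^sub>R w y \<partial>lborel) =
    (\<integral>y. (K (x - y) \<bullet> h) *\<^sub>R w y \<partial>lborel) + (\<integral>y. (K (x - y) \<bullet> h') *\<^sub>R w y \<partial>lborel)" for h h'
    unfolding inner_add_right scaleR_add_left
    by (rule Bochner_Integration.integral_add[OF conv_grad_integrable conv_grad_integrable])
  show "(\<integral>y. (K (x - y) \<bullet> (c *\<^sub>R h)) *\<^sub>R w y \<partial>lborel) = c *\<^sub>R (\<integral>y. (K (x - y) \<bullet> h) *\<^sub>R w y \<partial>lborel)" for c h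
    by (simp only: inner_scaleR_right scaleR_scaleR[symmetric] integral_scaleR_right)
qed

lemma conv_has_derivative:
  "(conv w has_derivative (\<lambda>h. \<integral>y. (K (x - y) \<bullet> h) *\<^sub>R w y \<partial>lborel)) (at x)"
proof (rule has_derivative_quadratic_remainder[OF conv_grad_linear])
  fix h
  have "(k (x + h - y)) *\<^sub>R w y - k (x - y) *\<^sub>R w y - (K (x - y) \<bullet> h) *\<^sub>R w y
      = (k (x - y + h) - k (x - y) - K (x - y) \<bullet> h) *\<^sub>R w y" for y
    by (simp only: scaleR_diff_left diff_add_eq)
  then have "has_bochner_integral lborel (\<lambda>y. (k (x - y + h) - k (x - y) - K (x - y) \<bullet> h) *\<^sub>R w y)
      (conv w (x + h) - conv w x - (\<integral>y. (K (x - y) \<bullet> h) *\<^sub>R w y \<partial>lborel))"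
    using has_bochner_integral_diff[OF has_bochner_integral_diff[OF
        has_bochner_integral_integrable[OF conv_integrable[of "x + h"]]
        has_bochner_integral_integrable[OF conv_integrable[of x]]]
        has_bochner_integral_integrable[OF conv_grad_integrable[of x h]]]
    by (simp only: conv_def)
  then have int: "integrable lborel (\<lambda>y. (k (x - y + h) - k (x - y) - K (x - y) \<bullet> h) *\<^sub>R w y)"
    and eq: "conv w (x + h) - conv w x - (\<integral>y. (K (x - y) \<bullet> h) *\<^sub>R w y \<partial>lborel)
      = (\<integral>y. (k (x - y + h) - k (x - y) - K (x - y) \<bullet> h) *\<^sub>R w y \<partial>lborel)"
    by (auto simp only: has_bochner_integral_iff)
  note eq
  also have "norm \<dots> \<le> (\<integral>y. (M * (norm h)\<^sup>2) * norm (w y) \<partial>lborel)"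
  proof (intro order_trans[OF integral_norm_bound] integral_mono integrable_norm int)
    show "norm ((k (x - y + h) - k (x - y) - K (x - y) \<bullet> h) *\<^sub>R w y) \<le> (M * (norm h)\<^sup>2) * norm (w y)" for y
      using taylor[of "x - y" h] by (auto intro!: mult_right_mono)
  qed (use w in simp)
  also have "\<dots> = (M * (\<integral>y. norm (w y) \<partial>lborel)) * (norm h)\<^sup>2"
    by simp
  finally show "norm (conv w (x + h) - conv w x - (\<integral>y. (K (x - y) \<bullet> h) *\<^sub>R w y \<partial>lborel))
      \<le> (M * (\<integral>y. norm (w y) \<partial>lborel)) * (norm h)\<^sup>2" .
qed

text \<open>The bound is linear in \<open>norm h\<close>, so it is a Lipschitz bound in operator
  norm. This gives the continuity of the derivative that \<open>C1_compact_support\<close>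
  demands.\<close>

lemma conv_grad_lipschitz:
  "norm ((\<integral>y. (K (x - y) \<bullet> h) *\<^sub>R w y \<partial>lborel) - (\<integral>y. (K (z - y) \<bullet> h) *\<^sub>R w y \<partial>lborel))
    \<le> (M * (\<integral>y. norm (w y) \<partial>lborel)) * norm (x - z) * norm h"
proof -
  have eq: "(K (x - y) \<bullet> h) *\<^sub>R w y - (K (z - y) \<bullet> h) *\<^sub>R w y = ((K (x - y) - K (z - y)) \<bullet> h) *\<^sub>R w y" for y
    unfolding inner_diff_left scaleR_diff_left ..
  note diff = Bochner_Integration.integrable_diff[OF conv_grad_integrable conv_grad_integrable, of x h z h, unfolded eq]
  have "(\<integral>y. (K (x - y) \<bullet> h) *\<^sub>R w y \<partial>lborel) - (\<integral>y. (K (z - y) \<bullet> h) *\<^sub>R w y \<partial>lborel)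
      = (\<integral>y. ((K (x - y) - K (z - y)) \<bullet> h) *\<^sub>R w y \<partial>lborel)"
    unfolding Bochner_Integration.integral_diff[OF conv_grad_integrable conv_grad_integrable, symmetric] eq ..
  also have "norm \<dots> \<le> (\<integral>y. (M * norm (x - z) * norm h) * norm (w y) \<partial>lborel)"
  proof (intro order_trans[OF integral_norm_bound] integral_mono integrable_norm diff)
    fix y
    have "\<bar>(K (x - y) - K (z - y)) \<bullet> h\<bar> \<le> norm (K (x - y) - K (z - y)) * norm h"
      by (rule Cauchy_Schwarz_ineq2)
    also have "\<dots> \<le> (M * norm (x - z)) * norm h"
      using grad_lipschitz[of "x - y" "z - y"] by (intro mult_right_mono) auto
    finally show "norm (((K (x - y) - K (z - y)) \<bullet> h) *\<^sub>R w y) \<le> (M * norm (x - z) * norm h) * norm (w y)"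
      by (auto intro!: mult_right_mono)
  qed (use w in simp)
  also have "\<dots> = (M * (\<integral>y. norm (w y) \<partial>lborel)) * norm (x - z) * norm h"
    by simp
  finally show ?thesis .
qed

lemma conv_lipschitz: "(M * (\<integral>y. norm (w y) \<partial>lborel))-lipschitz_on A (conv w)"
proof (rule lipschitz_on_subset[OF bounded_derivative_imp_lipschitz])
  show "(conv w has_derivative (\<lambda>h. \<integral>y. (K (x - y) \<bullet> h) *\<^sub>R w y \<partial>lborel)) (at x within UNIV)" for x
    using conv_has_derivative by simp
  show "onorm (\<lambda>h. \<integral>y. (K (x - y) \<bullet> h) *\<^sub>R w y \<partial>lborel) \<le> M * (\<integral>y. norm (w y) \<partial>lborel)" for x
    by (rule onorm_bound) (auto simp: conv_grad_bounded M_nonneg)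
qed (auto simp: M_nonneg)

lemma conv_support:
  assumes "\<And>y. w y \<noteq> 0 \<Longrightarrow> y \<in> A" and "\<And>y. y \<in> A \<Longrightarrow> r \<le> dist x y"
  shows "conv w x = 0" "(\<integral>y. (K (x - y) \<bullet> h) *\<^sub>R w y \<partial>lborel) = 0"
proof -
  have *: "r \<le> norm (x - y)" if "w y \<noteq> 0" for y
    using assms that by (simp add: dist_norm)
  have 1: "k (x - y) *\<^sub>R w y = 0" and 2: "(K (x - y) \<bullet> h) *\<^sub>R w y = 0" for y
    using support[of "x - y"] grad_support[of "x - y"] *[of y] by (cases "w y = 0"; simp)+
  show "conv w x = 0" "(\<integral>y. (K (x - y) \<bullet> h) *\<^sub>R w y \<partial>lborel) = 0"
    unfolding conv_def 1 2 by simp_all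
qed

text \<open>\<open>conv w x\<close> averages the values of \<open>w\<close> with nonnegative weights
  of total mass 1. Used both for test fields in the perimeter and for the mollified
  indicator.\<close>

lemma norm_conv_le:
  assumes "\<And>y. norm (w y) \<le> 1"
  shows "norm (conv w x) \<le> 1"
proof -
  have "norm (conv w x) \<le> (\<integral>y. k (x - y) \<partial>lborel)"
    unfolding conv_def
    using assms nonneg kernel_translate(2)[of x]
    by (intro order_trans[OF integral_norm_bound] integral_mono integrable_norm conv_integrable)
      (auto intro!: mult_left_le simp: has_bochner_integral_iff)
  then show ?thesis using kernel_translate(2)[of x] by (simp add: has_bochner_integral_iff)
qed

end

subsection \<open>Total variation of mollified indicators\<close>

text \<open>This turns an integrable, possibly discontinuous field of bounded support into one that
  is allowed in the definition of the perimeter.\<close>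

lemma conv_C1_compact_support:
  fixes w :: "'a \<Rightarrow> 'a"
  assumes w: "integrable lborel w" and supp: "\<And>y. w y \<noteq> 0 \<Longrightarrow> y \<in> B" and "bounded B"
  shows "C1_compact_support (conv w)"
  unfolding C1_compact_support_def
proof (intro conjI exI allI)
  define D where "D x = Blinfun (\<lambda>h. \<integral>y. (K (x - y) \<bullet> h) *\<^sub>R w y \<partial>lborel)" for x
  have D: "blinfun_apply (D x) = (\<lambda>h. \<integral>y. (K (x - y) \<bullet> h) *\<^sub>R w y \<partial>lborel)" for x
    unfolding D_def by (rule bounded_linear_Blinfun_apply[OF conv_grad_linear[OF w]])
  show "(conv w has_derivative blinfun_apply (D x)) (at x)" for x
    unfolding D by (rule conv_has_derivative[OF w])
  have "(M * (\<integral>y. norm (w y) \<partial>lborel))-lipschitz_on UNIV D"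
  proof (rule lipschitz_onI)
    show "0 \<le> M * (\<integral>y. norm (w y) \<partial>lborel)" by (simp add: M_nonneg)
    show "dist (D x) (D z) \<le> M * (\<integral>y. norm (w y) \<partial>lborel) * dist x z" for x z
      unfolding dist_norm
    proof (rule norm_blinfun_bound)
      show "norm (blinfun_apply (D x - D z) h) \<le> M * (\<integral>y. norm (w y) \<partial>lborel) * norm (x - z) * norm h" for h
        unfolding blinfun.diff_left D by (rule conv_grad_lipschitz[OF w])
    qed (simp add: M_nonneg)
  qed
  then show "continuous_on UNIV D" by (rule lipschitz_on_continuous_on)
  obtain R where R: "\<And>y. y \<in> B \<Longrightarrow> norm y \<le> R"
    using \<open>bounded B\<close> bounded_iff by blast
  have "conv w x = 0" if "norm x \<ge> R + r" for x
  proof (rule conv_support[OF w])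
    fix y assume "y \<in> B"
    then show "r \<le> dist x y"
      using R[of y] that norm_triangle_ineq2[of x y] by (simp add: dist_norm)
  qed (rule supp)
  then have "{x. conv w x \<noteq> 0} \<subseteq> cball 0 (R + r)"
    by (auto simp: not_le intro: less_imp_le) (meson linorder_le_cases)
  then show "compact (closure {x. conv w x \<noteq> 0})"
    using bounded_cball bounded_subset compact_closure by blast
qed

text \<open>The derivative is an integral of rank-one maps sending \<open>h\<close> to
  \<open>(K (x - y) \<bullet> h) *\<^sub>R w y\<close>, and the trace of such a map is
  \<open>K (x - y) \<bullet> w y\<close>.\<close>

lemma divergence_conv:
  fixes w :: "'a \<Rightarrow> 'a"
  assumes w: "integrable lborel w"
  shows "divergence (conv w) x = (\<integral>y. K (x - y) \<bullet> w y \<partial>lborel)"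
proof -
  have "divergence (conv w) x = (\<Sum>b\<in>Basis. (\<integral>y. (K (x - y) \<bullet> b) *\<^sub>R w y \<partial>lborel) \<bullet> b)"
    unfolding divergence_def frechet_derivative_at[OF conv_has_derivative[OF w], symmetric] ..
  also have "\<dots> = (\<Sum>b\<in>Basis. \<integral>y. ((K (x - y) \<bullet> b) *\<^sub>R w y) \<bullet> b \<partial>lborel)"
    using conv_grad_integrable[OF w] by (intro sum.cong refl integral_inner_left[symmetric])
  also have "\<dots> = (\<integral>y. (\<Sum>b\<in>Basis. ((K (x - y) \<bullet> b) *\<^sub>R w y) \<bullet> b) \<partial>lborel)"
    using conv_grad_integrable[OF w] by (intro Bochner_Integration.integral_sum[symmetric] integrable_inner_left)
  also have "\<dots> = (\<integral>y. K (x - y) \<bullet> w y \<partial>lborel)"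
    by (subst (2) euclidean_inner) simp
  finally show ?thesis .
qed

lemma grad_conv_integrable:
  assumes w: "integrable lborel w"
  shows "integrable lborel (\<lambda>y. w y *\<^sub>R K (x - y))"
proof (rule Bochner_Integration.integrable_bound)
  show "integrable lborel (\<lambda>y. M * w y)" using w by simp
  show "(\<lambda>y. w y *\<^sub>R K (x - y)) \<in> borel_measurable lborel" using w by measurable
  show "AE y in lborel. norm (w y *\<^sub>R K (x - y)) \<le> norm (M * w y)"
    using grad_bounded M_nonneg by (intro AE_I2) (simp add: abs_mult mult.commute[of M] mult_left_mono)
qed

text \<open>\<open>grad\<close> is a definite description, so uniqueness of the gradient has to be
  shown as well. The formula holds at every point, without an exceptional null set, and it makes
  \<open>grad\<close> of a convolution measurable.\<close>

lemma grad_conv: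
  assumes w: "integrable lborel w"
  shows "grad (conv w) x = (\<integral>y. w y *\<^sub>R K (x - y) \<partial>lborel)" (is "_ = ?G")
proof -
  have "(\<integral>y. (K (x - y) \<bullet> h) *\<^sub>R w y \<partial>lborel) = h \<bullet> ?G" for h
    using grad_conv_integrable[OF w]
    by (subst integral_inner_right[symmetric]) (auto simp: mult.commute inner_commute)
  then have G: "GDERIV (conv w) x :> ?G"
    using conv_has_derivative[OF w, of x] by (simp add: gderiv_def)
  show ?thesis
    unfolding grad_def
  proof (rule the_equality[where P = "\<lambda>D. GDERIV (conv w) x :> D", OF G])
    fix D assume "GDERIV (conv w) x :> D"
    then have "(\<lambda>h. h \<bullet> D) = (\<lambda>h. h \<bullet> ?G)"
      using G unfolding gderiv_def by (rule has_derivative_unique)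
    then show "D = ?G" by (metis vector_eq_ldot)
  qed
qed

context
  fixes E :: "'a set"
  assumes E [measurable]: "E \<in> sets borel" and "bounded E"
begin

lemma indicator_integrable: "integrable lborel (indicator E :: 'a \<Rightarrow> real)"
  using E emeasure_bounded_finite[OF \<open>bounded E\<close>] by simp

lemma grad_conv_indicator_measurable [measurable]: "grad (conv (indicator E)) \<in> borel_measurable borel"
  unfolding grad_conv[OF indicator_integrable, abs_def] by measurable

lemma grad_conv_indicator_bounded: "norm (grad (conv (indicator E)) x) \<le> M * measure lborel E"
proof -
  have "norm (grad (conv (indicator E)) x) \<le> (\<integral>y. M * indicator E y \<partial>lborel)"
    unfolding grad_conv[OF indicator_integrable]
    using grad_bounded
    by (intro order_trans[OF integral_norm_bound] integral_mono integrable_norm integrable_mult_right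
        indicator_integrable grad_conv_integrable) (simp add: indicator_def)
  then show ?thesis by simp
qed

lemma grad_conv_indicator_support:
  obtains R where "\<And>x. grad (conv (indicator E)) x \<noteq> 0 \<Longrightarrow> x \<in> cball 0 R"
proof -
  obtain R where R: "\<And>y. y \<in> E \<Longrightarrow> norm y \<le> R"
    using \<open>bounded E\<close> bounded_iff by blast
  have "grad (conv (indicator E)) x = 0" if "norm x \<ge> R + r" for x
  proof -
    have "indicator E y *\<^sub>R K (x - y) = 0" for y
      using R[of y] that norm_triangle_ineq2[of x y] grad_support[of "x - y"]
      by (cases "y \<in> E") auto
    then show ?thesis by (simp only: grad_conv[OF indicator_integrable]) simp
  qed
  then show thesis by (intro that[of "R + r"]) (force simp: not_le)
qed

lemma grad_conv_indicator_integrable: "integrable lborel (grad (conv (indicator E)))"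
proof -
  obtain R where R: "\<And>x. grad (conv (indicator E)) x \<noteq> 0 \<Longrightarrow> x \<in> cball 0 R"
    using grad_conv_indicator_support by blast
  show ?thesis
  proof (rule Bochner_Integration.integrable_bound)
    show "integrable lborel (\<lambda>x. (M * measure lborel E) * indicator (cball 0 R) x :: real)"
      by (intro integrable_mult_right integrable_real_indicator emeasure_lborel_cball_finite) simp
    show "AE x in lborel. norm (grad (conv (indicator E)) x) \<le> norm ((M * measure lborel E) * indicator (cball 0 R) x :: real)"
    proof (intro AE_I2)
      fix x
      show "norm (grad (conv (indicator E)) x) \<le> norm ((M * measure lborel E) * indicator (cball 0 R) x :: real)"
        using R[of x] grad_conv_indicator_bounded[of x] M_nonneg
        by (cases "grad (conv (indicator E)) x = 0") (auto simp: abs_mult)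
    qed
  qed simp
qed

text \<open>
  The supremum defining the perimeter is tested with the mollification of the discontinuous field
  \<open>- sgn (grad (conv (indicator E)))\<close>; Fubini and the oddness of \<open>K\<close> move the mollifier
  from the set onto the field.
\<close>
lemma total_variation_conv_le_perimeter:
  "ennreal (\<integral>x. norm (grad (conv (indicator E)) x) \<partial>lborel) \<le> perimeter E"
proof -
  define G where "G = grad (conv (indicator E))"
  \<comment> \<open>With this choice \<open>- (G x \<bullet> w x)\<close> equals
    \<open>norm (G x)\<close>, also where \<open>G x = 0\<close>. The minus sign is cancelled later
    by the oddness of \<open>K\<close>.\<close>
  define w where "w x = - sgn (G x)" for x
  have [measurable]: "G \<in> borel_measurable borel" unfolding G_def by measurable
  have [measurable]: "w \<in> borel_measurable borel" unfolding w_def sgn_div_norm by measurable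
  have w1: "norm (w x) \<le> 1" for x by (simp add: w_def norm_sgn)
  obtain R where R: "\<And>x. G x \<noteq> 0 \<Longrightarrow> x \<in> cball 0 R"
    using grad_conv_indicator_support unfolding G_def by blast
  have wR: "x \<in> cball 0 R" if "w x \<noteq> 0" for x
    using R[of x] that by (auto simp: w_def sgn_zero_iff)
  have w: "integrable lborel w"
  proof (rule Bochner_Integration.integrable_bound)
    show "integrable lborel (indicator (cball 0 R) :: 'a \<Rightarrow> real)"
      using emeasure_lborel_cball_finite[of "0::'a" R] by auto
    show "AE x in lborel. norm (w x) \<le> norm (indicator (cball 0 R) x :: real)"
      using w1 wR by (auto simp: indicator_def)
  qed simp
  define F where "F = (\<lambda>(x, y). indicator E y * (K (x - y) \<bullet> w x))"
  \<comment> \<open>\<open>F\<close> is bounded by \<open>M\<close> and vanishes off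
    \<open>cball 0 R \<times> E\<close>, a set of finite measure; this is what permits exchanging
    the integrals.\<close>
  have F: "integrable (lborel \<Otimes>\<^sub>M lborel) F"
  proof (rule Bochner_Integration.integrable_bound)
    have "emeasure (lborel \<Otimes>\<^sub>M lborel) (cball (0::'a) R \<times> E) < \<infinity>"
      using emeasure_lborel_cball_finite[of "0::'a" R] emeasure_bounded_finite[OF \<open>bounded E\<close>]
      by (subst lborel.emeasure_pair_measure_Times) (auto simp: ennreal_mult_less_top)
    then show "integrable (lborel \<Otimes>\<^sub>M lborel) (\<lambda>z. M * indicator (cball (0::'a) R \<times> E) z)"
      by (intro integrable_mult_right integrable_real_indicator) auto
    show "F \<in> borel_measurable (lborel \<Otimes>\<^sub>M lborel)"
      unfolding F_def by measurable
    show "AE z in lborel \<Otimes>\<^sub>M lborel. norm (F z) \<le> norm (M * indicator (cball 0 R \<times> E) z)"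
    proof (intro AE_I2)
      fix z :: "'a \<times> 'a"
      obtain x y where z: "z = (x, y)" by force
      have "\<bar>K (x - y) \<bullet> w x\<bar> \<le> norm (K (x - y)) * norm (w x)" by (rule Cauchy_Schwarz_ineq2)
      also have "\<dots> \<le> M * 1" by (intro mult_mono grad_bounded w1 M_nonneg) auto
      finally show "norm (F z) \<le> norm (M * indicator (cball 0 R \<times> E) z)"
        using wR[of x] M_nonneg unfolding F_def z
        by (cases "w x = 0"; cases "y \<in> E") (auto simp: abs_mult)
    qed
  qed
  have "(\<integral>x. norm (G x) \<partial>lborel) = (\<integral>x. - (G x \<bullet> w x) \<partial>lborel)"
  proof (intro Bochner_Integration.integral_cong refl)
    show "norm (G x) = - (G x \<bullet> w x)" for x
      by (cases "G x = 0") (auto simp: w_def sgn_div_norm dot_square_norm power2_eq_square)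
  qed
  also have "\<dots> = - (\<integral>x. (\<integral>y. F (x, y) \<partial>lborel) \<partial>lborel)"
  proof -
    have "G x \<bullet> w x = (\<integral>y. F (x, y) \<partial>lborel)" for x
      using grad_conv_integrable[OF indicator_integrable, of x]
      unfolding G_def F_def grad_conv[OF indicator_integrable]
      by (subst integral_inner_left[symmetric]) auto
    then show ?thesis by simp
  qed
  also have "(\<integral>x. (\<integral>y. F (x, y) \<partial>lborel) \<partial>lborel) = (\<integral>y. (\<integral>x. F (x, y) \<partial>lborel) \<partial>lborel)"
    using lborel_pair.Fubini_integral[of "\<lambda>x y. F (x, y)"] F by simp
  also have "- \<dots> = (\<integral>y. indicator E y *\<^sub>R divergence (conv w) y \<partial>lborel)"
  proof -
    have "- (\<integral>x. F (x, y) \<partial>lborel) = indicator E y *\<^sub>R divergence (conv w) y" for y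
    proof -
      have K: "K (y - x) = - K (x - y)" for x
        using grad_odd[of "x - y"] by simp
      show ?thesis
        unfolding divergence_conv[OF w] F_def by (simp add: K)
    qed
    then show ?thesis by (metis (no_types, lifting) Bochner_Integration.integral_cong integral_minus)
  qed
  \<comment> \<open>The perimeter is stated with the completed measure; the integrand here is Borel,
    so both integrals agree.\<close>
  also have "\<dots> = (LINT y:E|lebesgue. divergence (conv w) y)"
    unfolding set_lebesgue_integral_def
    by (rule integral_completion[symmetric]) (simp only: divergence_conv[OF w], measurable)
  finally have "ennreal (\<integral>x. norm (G x) \<partial>lborel) = ennreal (LINT y:E|lebesgue. divergence (conv w) y)"
    by simp
  also have "\<dots> \<le> perimeter E"
    unfolding perimeter_def
    using conv_C1_compact_support[OF w wR bounded_cball] norm_conv_le[OF w w1]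
    by (intro SUP_upper) auto
  finally show ?thesis unfolding G_def .
qed

text \<open>The difference at \<open>x\<close> is an average of
  \<open>indicator E y - indicator E x\<close> over \<open>y\<close> within distance
  \<open>r\<close>. When this is nonzero, one of the two points is in \<open>E\<close> and the other
  is not. Either the one in \<open>E\<close> lies outside \<open>C\<close>, hence in
  \<open>U - C\<close>, or it lies in \<open>C\<close>, and then the other is in \<open>U\<close> by
  \<open>far\<close> and again in \<open>U - C\<close>. Charging the weight to \<open>I x\<close> or
  \<open>I y\<close> and integrating gives the measure of \<open>U - C\<close> twice.\<close>

lemma conv_indicator_L1:
  assumes "C \<subseteq> E" "E \<subseteq> U" and [measurable]: "C \<in> sets borel" "U \<in> sets borel"
    and far: "\<And>x y. x \<in> C \<Longrightarrow> dist x y < r \<Longrightarrow> y \<in> U"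
  shows "(\<integral>\<^sup>+x. ennreal \<bar>conv (indicator E) x - indicator E x\<bar> \<partial>lborel) \<le> 2 * emeasure lborel (U - C)"
proof -
  define I :: "'a \<Rightarrow> ennreal" where "I = indicator (U - C)"
  have [measurable]: "I \<in> borel_measurable borel" unfolding I_def by measurable
  have k1: "(\<integral>\<^sup>+y. ennreal (k (x - y)) \<partial>lborel) = 1" "(\<integral>\<^sup>+y. ennreal (k (y - x)) \<partial>lborel) = 1" for x
    using kernel_translate[of x] nonneg by (simp_all add: nn_integral_eq_integral has_bochner_integral_iff)
  have le: "ennreal \<bar>conv (indicator E) x - indicator E x\<bar>
      \<le> (\<integral>\<^sup>+y. ennreal (k (x - y)) * I x + ennreal (k (x - y)) * I y \<partial>lborel)" for x
  proof -
    have hb: "has_bochner_integral lborel (\<lambda>y. k (x - y) * (indicator E y - indicator E x))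
        (conv (indicator E) x - indicator E x)"
      using has_bochner_integral_diff[OF
          has_bochner_integral_integrable[OF conv_integrable[OF indicator_integrable, of x]]
          has_bochner_integral_mult_left[OF kernel_translate(2)[of x], of "indicator E x"]]
      by (simp add: conv_def algebra_simps)
    have "ennreal \<bar>conv (indicator E) x - indicator E x\<bar>
        \<le> (\<integral>\<^sup>+y. ennreal (norm (k (x - y) * (indicator E y - indicator E x))) \<partial>lborel)"
      using integral_norm_bound_ennreal[of lborel "\<lambda>y. k (x - y) * (indicator E y - indicator E x)"] hb
      by (simp add: has_bochner_integral_iff)
    also have "\<dots> \<le> (\<integral>\<^sup>+y. ennreal (k (x - y)) * I x + ennreal (k (x - y)) * I y \<partial>lborel)"
    proof (intro nn_integral_mono)
      fix y
      consider "r \<le> norm (x - y)" | "x \<in> E \<longleftrightarrow> y \<in> E" | "dist x y < r" "x \<in> E" "y \<notin> E"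
        | "dist y x < r" "x \<notin> E" "y \<in> E"
        using linorder_le_less_linear[of r "norm (x - y)"]
        by (auto simp: dist_norm norm_minus_commute)
      then show "ennreal (norm (k (x - y) * (indicator E y - indicator E x)))
          \<le> ennreal (k (x - y)) * I x + ennreal (k (x - y)) * I y"
      proof cases
        case 1
        then show ?thesis by (simp add: support)
      next
        case 2
        then show ?thesis by (auto simp: indicator_def)
      next
        case 3
        then have "x \<in> U - C \<or> y \<in> U - C" using assms(1,2) far[of x y] by auto
        then show ?thesis using 3 nonneg by (auto simp: I_def)
      next
        case 4
        then have "x \<in> U - C \<or> y \<in> U - C" using assms(1,2) far[of y x] by auto
        then show ?thesis using 4 nonneg by (auto simp: I_def)
      qed
    qed
    finally show ?thesis .
  qed
  have "(\<integral>\<^sup>+x. ennreal \<bar>conv (indicator E) x - indicator E x\<bar> \<partial>lborel)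
      \<le> (\<integral>\<^sup>+x. (\<integral>\<^sup>+y. ennreal (k (x - y)) * I x + ennreal (k (x - y)) * I y \<partial>lborel) \<partial>lborel)"
    by (intro nn_integral_mono le)
  also have "\<dots> = (\<integral>\<^sup>+x. (\<integral>\<^sup>+y. ennreal (k (x - y)) * I x \<partial>lborel) + (\<integral>\<^sup>+y. ennreal (k (x - y)) * I y \<partial>lborel) \<partial>lborel)"
    by (intro nn_integral_cong nn_integral_add) measurable
  also have "\<dots> = (\<integral>\<^sup>+x. (\<integral>\<^sup>+y. ennreal (k (x - y)) * I x \<partial>lborel) \<partial>lborel)
      + (\<integral>\<^sup>+x. (\<integral>\<^sup>+y. ennreal (k (x - y)) * I y \<partial>lborel) \<partial>lborel)"
    by (intro nn_integral_add) measurable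
  also have "(\<integral>\<^sup>+x. (\<integral>\<^sup>+y. ennreal (k (x - y)) * I y \<partial>lborel) \<partial>lborel)
      = (\<integral>\<^sup>+y. (\<integral>\<^sup>+x. ennreal (k (x - y)) * I y \<partial>lborel) \<partial>lborel)"
    by (intro lborel_pair.Fubini') measurable
  also have "(\<integral>\<^sup>+x. (\<integral>\<^sup>+y. ennreal (k (x - y)) * I x \<partial>lborel) \<partial>lborel)
      + (\<integral>\<^sup>+y. (\<integral>\<^sup>+x. ennreal (k (x - y)) * I y \<partial>lborel) \<partial>lborel) = emeasure lborel (U - C) + emeasure lborel (U - C)"
    by (simp add: nn_integral_multc k1) (simp add: I_def)
  finally show ?thesis by (simp add: mult_2)
qed

end

end

section \<open>Lipschitz test functions close to the indicator\<close>

lemma mollified_indicator: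
  fixes E :: "'a::euclidean_space set"
  assumes [measurable]: "E \<in> sets borel" and "compactly_contained E \<Omega>" "open \<Omega>" and "e > 0"
  obtains \<psi> :: "'a \<Rightarrow> real" and L where "L-lipschitz_on UNIV \<psi>" "\<And>x. x \<notin> \<Omega> \<Longrightarrow> \<psi> x = 0"
    "\<And>x. \<bar>\<psi> x\<bar> \<le> 1" "integrable lborel (grad \<psi>)"
    "ennreal (\<integral>x. norm (grad \<psi> x) \<partial>lborel) \<le> perimeter E"
    "(\<integral>\<^sup>+x. ennreal \<bar>\<psi> x - indicator E x\<bar> \<partial>lborel) \<le> ennreal e"
proof -
  have cl: "compact (closure E)" "closure E \<subseteq> \<Omega>"
    using assms(2) by (auto simp: compactly_contained_def)
  then have "bounded E" by (meson bounded_subset closure_subset compact_imp_bounded)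
  have E: "E \<in> sets lebesgue" by simp
  \<comment> \<open>Two errors of \<open>e / 4\<close> leave \<open>U - C\<close> with measure at
    most \<open>e / 2\<close>, and \<open>conv_indicator_L1\<close> doubles it.\<close>
  have e4: "e / 4 > 0" using \<open>e > 0\<close> by simp
  obtain C where C: "closed C" "C \<subseteq> E" "E - C \<in> lmeasurable" "emeasure lebesgue (E - C) < ennreal (e / 4)"
    by (rule sets_lebesgue_inner_closed[OF E e4])
  obtain U where U: "open U" "E \<subseteq> U" "U - E \<in> lmeasurable" "emeasure lebesgue (U - E) < ennreal (e / 4)"
    by (rule sets_lebesgue_outer_open[OF E e4])
  have [measurable]: "C \<in> sets borel" "U \<in> sets borel"
    using C(1) U(1) by (auto intro: borel_closed borel_open)
  have "compact C"
    using C \<open>bounded E\<close> bounded_subset compact_eq_bounded_closed by blast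
  then obtain d1 where d1: "d1 > 0" "(\<Union>x\<in>C. ball x d1) \<subseteq> U"
    using compact_subset_open_imp_ball_epsilon_subset[of C U] C U by blast
  obtain d2 where d2: "d2 > 0" "(\<Union>x\<in>closure E. ball x d2) \<subseteq> \<Omega>"
    using compact_subset_open_imp_ball_epsilon_subset[OF cl(1) \<open>open \<Omega>\<close> cl(2)] by blast
  \<comment> \<open>Below \<open>d1\<close> the kernel does not carry points of \<open>C\<close> out
    of \<open>U\<close>, which is the hypothesis \<open>far\<close>; below \<open>d2\<close> it does
    not carry \<open>E\<close> out of \<open>\<Omega>\<close>, so the mollification vanishes
    there.\<close>
  obtain k :: "'a \<Rightarrow> real" and K M where "mollifier (min d1 d2) k K M"
    using mollifier_exists[of "min d1 d2"] d1 d2 by auto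
  then interpret mollifier "min d1 d2" k K M .
  note ind = indicator_integrable[OF \<open>E \<in> sets borel\<close> \<open>bounded E\<close>]
  show thesis
  proof (rule that[of _ "conv (indicator E)"])
    show "(M * (\<integral>y. norm (indicator E y :: real) \<partial>lborel))-lipschitz_on UNIV (conv (indicator E :: 'a \<Rightarrow> real))"
      by (rule conv_lipschitz[OF ind])
    show "conv (indicator E) x = (0::real)" if "x \<notin> \<Omega>" for x
    proof (rule conv_support(1)[OF ind])
      fix y assume "y \<in> E"
      then have "ball y d2 \<subseteq> \<Omega>" using d2 closure_subset by blast
      then have "d2 \<le> dist x y" using that by (meson dist_commute_lessI linorder_not_le mem_ball subsetD)
      then show "min d1 d2 \<le> dist x y" by simp
    qed (simp add: indicator_def split: if_splits)
    show "\<bar>conv (indicator E) x\<bar> \<le> (1::real)" for x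
      using norm_conv_le[OF ind, of x] by (simp add: indicator_def)
    show "integrable lborel (grad (conv (indicator E)))"
      by (rule grad_conv_indicator_integrable) fact+
    show "ennreal (\<integral>x. norm (grad (conv (indicator E)) x) \<partial>lborel) \<le> perimeter E"
      by (rule total_variation_conv_le_perimeter) fact+
    have "emeasure lborel (U - C) = emeasure lborel ((U - E) \<union> (E - C))"
      using C U by (intro arg_cong[where f = "emeasure lborel"]) auto
    also have "\<dots> \<le> emeasure lborel (U - E) + emeasure lborel (E - C)"
      by (intro emeasure_subadditive) auto
    also have "\<dots> \<le> ennreal (e / 4) + ennreal (e / 4)"
      using C U by (intro add_mono less_imp_le) auto
    finally have UC: "emeasure lborel (U - C) \<le> ennreal (e / 2)"
      using \<open>e > 0\<close> by (simp flip: ennreal_plus)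
    have "(\<integral>\<^sup>+x. ennreal \<bar>conv (indicator E) x - indicator E x\<bar> \<partial>lborel) \<le> 2 * emeasure lborel (U - C)"
      using C U d1 by (intro conv_indicator_L1 \<open>bounded E\<close>) (auto simp: subset_iff)
    also have "\<dots> \<le> 2 * ennreal (e / 2)" by (intro mult_left_mono UC) auto
    also have "\<dots> = ennreal e" using ennreal_mult'[of 2 "e / 2"] by simp
    finally show "(\<integral>\<^sup>+x. ennreal \<bar>conv (indicator E) x - indicator E x\<bar> \<partial>lborel) \<le> ennreal e" .
  qed
qed

subsection \<open>Testing the equation\<close>

text \<open>By Cauchy-Schwarz, since the vector
  \<open>norm (grad u x) ^ (p - 2) *\<^sub>R grad u x\<close> has norm
  \<open>norm (grad u x) ^ (p - 1)\<close>, which is at most \<open>\<sigma> ^ (p - 1)\<close>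
  almost everywhere in \<open>\<Omega>\<close>.\<close>

lemma p_form_bound:
  assumes \<Omega>: "\<Omega> \<in> sets lebesgue" and u: "AE x in lebesgue_on \<Omega>. norm (grad u x) \<le> \<sigma>"
    and "0 \<le> \<sigma>" "p \<ge> 2" and \<psi>: "integrable lborel (grad \<psi>)"
  shows "\<bar>p_form \<Omega> p u \<psi>\<bar> \<le> \<sigma> ^ (p - 1) * (\<integral>x. norm (grad \<psi> x) \<partial>lborel)"
proof -
  define F where "F x = indicator \<Omega> x *\<^sub>R ((norm (grad u x) ^ (p - 2) *\<^sub>R grad u x) \<bullet> grad \<psi> x)" for x
  have "AE x in lebesgue. x \<in> \<Omega> \<longrightarrow> norm (grad u x) \<le> \<sigma>"
    using u \<Omega> by (subst (asm) AE_restrict_space_iff) auto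
  then have le: "AE x in lebesgue. \<bar>F x\<bar> \<le> \<sigma> ^ (p - 1) * norm (grad \<psi> x)"
  proof eventually_elim
    case (elim x)
    show ?case
    proof (cases "x \<in> \<Omega>")
      case True
      have p: "p - 1 = Suc (p - 2)" using \<open>p \<ge> 2\<close> by simp
      have "\<bar>F x\<bar> \<le> norm (norm (grad u x) ^ (p - 2) *\<^sub>R grad u x) * norm (grad \<psi> x)"
        using True unfolding F_def by (simp only: indicator_simps scaleR_one Cauchy_Schwarz_ineq2)
      also have "\<dots> = norm (grad u x) ^ (p - 1) * norm (grad \<psi> x)"
        by (simp only: p norm_scaleR abs_norm_cancel norm_power abs_of_nonneg norm_ge_zero zero_le_power power_Suc mult.commute)
      also have "\<dots> \<le> \<sigma> ^ (p - 1) * norm (grad \<psi> x)"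
        using True elim by (intro mult_right_mono power_mono) auto
      finally show ?thesis .
    qed (use \<open>0 \<le> \<sigma>\<close> in \<open>simp add: F_def\<close>)
  qed
  have int: "integrable lebesgue (\<lambda>x. \<sigma> ^ (p - 1) * norm (grad \<psi> x))"
    using \<psi> by (subst integrable_completion) auto
  have eq: "(\<integral>x. \<sigma> ^ (p - 1) * norm (grad \<psi> x) \<partial>lebesgue) = \<sigma> ^ (p - 1) * (\<integral>x. norm (grad \<psi> x) \<partial>lborel)"
    using \<psi> by (subst integral_completion) auto
  \<comment> \<open>\<open>F\<close> and \<open>- F\<close> are compared with the bound separately:
    \<open>integral_mono_AE'\<close> asks for integrability of the larger, nonnegative function
    only, so measurability of \<open>grad u\<close> never has to be discussed.\<close>
  have "(\<integral>x. F x \<partial>lebesgue) \<le> (\<integral>x. \<sigma> ^ (p - 1) * norm (grad \<psi> x) \<partial>lebesgue)"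
    using le \<open>0 \<le> \<sigma>\<close> by (intro integral_mono_AE' int) (auto elim: eventually_mono)
  moreover have "(\<integral>x. - F x \<partial>lebesgue) \<le> (\<integral>x. \<sigma> ^ (p - 1) * norm (grad \<psi> x) \<partial>lebesgue)"
    using le \<open>0 \<le> \<sigma>\<close> by (intro integral_mono_AE' int) (auto elim: eventually_mono)
  ultimately show ?thesis
    unfolding p_form_def set_lebesgue_integral_def F_def[symmetric] eq by simp
qed

text \<open>For nonnegative terms both the extended and the real sum are suprema of finite partial
  sums, so finiteness of the first bounds the partial sums of the second.\<close>

lemma Lambda_finite:
  assumes "\<And>p. p \<ge> 2 \<Longrightarrow> a p \<ge> 0" "0 \<le> \<sigma>" and fin: "Lambda a \<sigma> < \<infinity>"
  shows "(\<lambda>p. a p * \<sigma> ^ (p - 1)) summable_on {2..}"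
    and "Lambda a \<sigma> = ennreal (\<Sum>\<^sub>\<infinity>p\<in>{2..}. a p * \<sigma> ^ (p - 1))"
proof -
  let ?t = "\<lambda>p. a p * \<sigma> ^ (p - 1)"
  have nn: "?t p \<ge> 0" if "p \<in> {2..}" for p
    using assms that by simp
  have sum: "(\<Sum>p\<in>F. ennreal (?t p)) = ennreal (sum ?t F)" if "F \<subseteq> {2..}" for F
    using nn that by (intro sum_ennreal) auto
  have Sup: "Lambda a \<sigma> = (SUP F\<in>{F. finite F \<and> F \<subseteq> {2..}}. ennreal (sum ?t F))"
    unfolding Lambda_def by (subst nonneg_infsum_complete) (use sum in \<open>auto intro!: SUP_cong simp del: One_nat_def\<close>)
  show summable: "?t summable_on {2..}"
  proof (rule nonneg_bdd_above_summable_on[OF nn])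
    have "sum ?t F \<le> enn2real (Lambda a \<sigma>)" if "F \<subseteq> {2..}" "finite F" for F
    proof -
      have "ennreal (sum ?t F) \<le> Lambda a \<sigma>"
        unfolding Sup using that by (intro SUP_upper) auto
      then show ?thesis
        using enn2real_mono[of "ennreal (sum ?t F)" "Lambda a \<sigma>"] fin sum_nonneg[of F ?t] nn that by (auto simp: subset_iff)
    qed
    then show "bdd_above (sum ?t ` {F. F \<subseteq> {2..} \<and> finite F})"
      by (auto intro!: bdd_aboveI2)
  qed
  show "Lambda a \<sigma> = ennreal (infsum ?t {2..})"
    unfolding Sup by (rule infsum_nonneg_is_SUPREMUM_ennreal[OF summable nn, symmetric])
qed

section \<open>Null sets: integrals and perimeter\<close>

lemma set_integral_Un_null_set:
  fixes g :: "'a::euclidean_space \<Rightarrow> real"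
  assumes [measurable]: "g \<in> borel_measurable lebesgue" "C \<in> sets lebesgue" and T: "T \<in> null_sets lebesgue"
  shows "(LINT x:C \<union> T|lebesgue. g x) = (LINT x:C|lebesgue. g x)"
proof (rule set_integral_cong_set)
  have [measurable]: "T \<in> sets lebesgue" using T by auto
  show "set_borel_measurable lebesgue C g" "set_borel_measurable lebesgue (C \<union> T) g"
    unfolding set_borel_measurable_def by measurable
  show "AE x in lebesgue. x \<in> C \<longleftrightarrow> x \<in> C \<union> T"
    using AE_not_in[OF T] by eventually_elim auto
qed

lemma continuous_divergence:
  assumes "C1_compact_support \<phi>"
  shows "continuous_on UNIV (divergence \<phi>)"
proof -
  obtain D where D: "\<And>x. (\<phi> has_derivative blinfun_apply (D x)) (at x)" "continuous_on UNIV D"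
    using assms unfolding C1_compact_support_def by blast
  have "divergence \<phi> = (\<lambda>x. \<Sum>b\<in>Basis. blinfun_apply (D x) b \<bullet> b)"
    unfolding divergence_def frechet_derivative_at[OF D(1), symmetric] ..
  then show ?thesis
    using D(2) by (auto intro!: continuous_intros)
qed

text \<open>The set enters the perimeter only through integrals of divergences. These are
  continuous, hence measurable, and such integrals ignore null sets.\<close>

lemma perimeter_Un_null_set:
  assumes "C \<in> sets lebesgue" "T \<in> null_sets lebesgue"
  shows "perimeter (C \<union> T) = perimeter C"
  unfolding perimeter_def
proof (intro SUP_cong refl)
  fix \<phi> :: "'a \<Rightarrow> 'a" assume "\<phi> \<in> {\<phi>. C1_compact_support \<phi> \<and> (\<forall>x. norm (\<phi> x) \<le> 1)}"
  then have "divergence \<phi> \<in> borel_measurable lborel"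
    using continuous_divergence borel_measurable_continuous_onI by auto
  then have "divergence \<phi> \<in> borel_measurable lebesgue"
    by (rule measurable_completion)
  then show "ennreal (LINT x:C \<union> T|lebesgue. divergence \<phi> x) = ennreal (LINT x:C|lebesgue. divergence \<phi> x)"
    by (simp add: set_integral_Un_null_set assms)
qed

lemma lebesgue_set_borel_Un_null:
  assumes "E \<in> sets lebesgue"
  obtains C T where "C \<in> sets borel" "T \<in> null_sets lebesgue" "E = C \<union> T"
proof -
  obtain C N N' where "E = C \<union> N" "N \<subseteq> N'" "N' \<in> null_sets lborel" "C \<in> sets lborel"
    using assms by (rule sets_completionE)
  moreover from this have "N \<in> null_sets lebesgue"
    unfolding null_sets_completion_iff2 by blast
  ultimately show thesis
    by (intro that[of C N]) (simp_all only: sets_lborel)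
qed

section \<open>The flux bound\<close>

text \<open>The terms are dominated by \<open>a p * \<sigma> ^ (p - 1)\<close> times the total
  variation of \<open>\<psi>\<close>. This gives the absolute convergence under which
  \<open>weak_solution\<close> provides the equation, and then the estimate of its left
  side.\<close>

lemma weak_solution_test_bound:
  assumes sol: "weak_solution \<Omega> a \<sigma> f g u" and "open \<Omega>"
    and a: "\<And>p. p \<ge> 2 \<Longrightarrow> a p \<ge> 0" and \<sigma>: "0 \<le> \<sigma>"
    and summable: "(\<lambda>p. a p * \<sigma> ^ (p - 1)) summable_on {2..}"
    and \<psi>: "\<psi> \<in> W0_1_inf \<Omega>" "integrable lborel (grad \<psi>)"
  shows "\<bar>LINT x:\<Omega>|lebesgue. f x * \<psi> x\<bar>
    \<le> (\<Sum>\<^sub>\<infinity>p\<in>{2..}. a p * \<sigma> ^ (p - 1)) * (\<integral>x. norm (grad \<psi> x) \<partial>lborel)"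
proof -
  let ?V = "\<integral>x. norm (grad \<psi> x) \<partial>lborel"
  have u: "AE x in lebesgue_on \<Omega>. norm (grad u x) \<le> \<sigma>"
    using sol by (simp add: weak_solution_def S_class_def)
  have "\<Omega> \<in> sets lebesgue" using \<open>open \<Omega>\<close> by simp
  note bound = p_form_bound[OF this u \<sigma> _ \<psi>(2)]
  have le: "a p * \<bar>p_form \<Omega> p u \<psi>\<bar> \<le> (a p * \<sigma> ^ (p - 1)) * ?V" if "p \<in> {2..}" for p
    using mult_left_mono[OF bound a, of p p] that by (simp add: mult.assoc)
  have s: "(\<lambda>p. (a p * \<sigma> ^ (p - 1)) * ?V) summable_on {2..}"
    using summable by (rule summable_on_cmult_left)
  have s': "(\<lambda>p. a p * \<bar>p_form \<Omega> p u \<psi>\<bar>) summable_on {2..}"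
    by (rule summable_on_comparison_test[OF s le]) (auto simp: a)
  then have eq: "(\<Sum>\<^sub>\<infinity>p\<in>{2..}. a p * p_form \<Omega> p u \<psi>) = (LINT x:\<Omega>|lebesgue. f x * \<psi> x)"
    using sol \<psi> by (simp add: weak_solution_def)
  have abs: "\<bar>a p * p_form \<Omega> p u \<psi>\<bar> = a p * \<bar>p_form \<Omega> p u \<psi>\<bar>" if "p \<in> {2..}" for p
    using a that by (simp add: abs_mult)
  then have "(\<lambda>p. \<bar>a p * p_form \<Omega> p u \<psi>\<bar>) summable_on {2..}"
    using s' by (subst summable_on_cong[OF abs])
  then have "\<bar>\<Sum>\<^sub>\<infinity>p\<in>{2..}. a p * p_form \<Omega> p u \<psi>\<bar> \<le> (\<Sum>\<^sub>\<infinity>p\<in>{2..}. \<bar>a p * p_form \<Omega> p u \<psi>\<bar>)"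
    using norm_infsum_bound[of "\<lambda>p. a p * p_form \<Omega> p u \<psi>" "{2..}"] by simp
  also have "\<dots> = (\<Sum>\<^sub>\<infinity>p\<in>{2..}. a p * \<bar>p_form \<Omega> p u \<psi>\<bar>)"
    using abs by (rule infsum_cong)
  also have "\<dots> \<le> (\<Sum>\<^sub>\<infinity>p\<in>{2..}. (a p * \<sigma> ^ (p - 1)) * ?V)"
    using s' s le by (rule infsum_mono)
  also have "\<dots> = (\<Sum>\<^sub>\<infinity>p\<in>{2..}. a p * \<sigma> ^ (p - 1)) * ?V"
    using summable by (rule infsum_cmult_left)
  finally show ?thesis unfolding eq .
qed

lemma weak_solution_flux_bound_borel:
  fixes \<Omega> E :: "'a::euclidean_space set"
  assumes sol: "weak_solution \<Omega> a \<sigma> f g u" and "open \<Omega>" and f: "set_integrable lebesgue \<Omega> f"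
    and a: "\<And>p. p \<ge> 2 \<Longrightarrow> a p \<ge> 0" and \<sigma>: "0 \<le> \<sigma>" and fin: "Lambda a \<sigma> < \<infinity>"
    and E [measurable]: "E \<in> sets borel" and cc: "compactly_contained E \<Omega>" and "perimeter E < \<infinity>"
  shows "ennreal \<bar>LINT x:E|lebesgue. f x\<bar> \<le> Lambda a \<sigma> * perimeter E"
proof -
  let ?S = "\<Sum>\<^sub>\<infinity>p\<in>{2..}. a p * \<sigma> ^ (p - 1)"
  note summable = Lambda_finite(1)[OF a \<sigma> fin] and Lambda_eq = Lambda_finite(2)[OF a \<sigma> fin]
  have S: "?S \<ge> 0" using a \<sigma> by (intro infsum_nonneg) auto
  obtain P where P: "perimeter E = ennreal P" "P \<ge> 0"
    using \<open>perimeter E < \<infinity>\<close> by (cases "perimeter E") auto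
  have cl: "compact (closure E)" "closure E \<subseteq> \<Omega>"
    using cc by (auto simp: compactly_contained_def)
  then have "bounded E" by (meson bounded_subset closure_subset compact_imp_bounded)
  have "E \<subseteq> \<Omega>" using cl closure_subset by blast
  define e where "e n = inverse (real (Suc n))" for n
  have e: "e n > 0" for n by (simp add: e_def)
  \<comment> \<open>Bundling the properties into one predicate lets a single choice pick
    \<open>\<psi> n\<close> for all \<open>n\<close> at once.\<close>
  define approx where "approx n \<psi> \<longleftrightarrow> (\<exists>L. L-lipschitz_on UNIV \<psi>) \<and> (\<forall>x. x \<notin> \<Omega> \<longrightarrow> \<psi> x = 0)
      \<and> (\<forall>x. \<bar>\<psi> x\<bar> \<le> 1) \<and> integrable lborel (grad \<psi>)
      \<and> ennreal (\<integral>x. norm (grad \<psi> x) \<partial>lborel) \<le> perimeter E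
      \<and> (\<integral>\<^sup>+x. ennreal \<bar>\<psi> x - indicator E x\<bar> \<partial>lborel) \<le> ennreal (e n)" for n \<psi>
  have "\<exists>\<psi>. approx n \<psi>" for n
    unfolding approx_def by (rule mollified_indicator[OF E cc \<open>open \<Omega>\<close> e[of n]]) blast
  then obtain \<psi> where \<psi>: "\<And>n. approx n (\<psi> n)"
    by metis
  have lip: "\<exists>L. L-lipschitz_on UNIV (\<psi> n)" and zero: "x \<notin> \<Omega> \<Longrightarrow> \<psi> n x = 0"
    and le1: "\<bar>\<psi> n x\<bar> \<le> 1" and grad: "integrable lborel (grad (\<psi> n))"
    and V: "ennreal (\<integral>x. norm (grad (\<psi> n) x) \<partial>lborel) \<le> perimeter E"
    and L1: "(\<integral>\<^sup>+x. ennreal \<bar>\<psi> n x - indicator E x\<bar> \<partial>lborel) \<le> ennreal (e n)" for n x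
    using \<psi>[of n] unfolding approx_def by blast+
  have [measurable]: "\<psi> n \<in> borel_measurable borel" for n
    using lip[of n] by (auto intro: borel_measurable_continuous_onI lipschitz_on_continuous_on)
  have bound: "\<bar>LINT x:\<Omega>|lebesgue. f x * \<psi> n x\<bar> \<le> ?S * P" for n
  proof -
    have "\<psi> n \<in> W0_1_inf \<Omega>"
      \<comment> \<open>The frontier of an open set is disjoint from it, so vanishing off
        \<open>\<Omega>\<close> includes vanishing on the frontier.\<close>
      using lip[of n] lipschitz_on_subset[of _ UNIV "\<psi> n" "closure \<Omega>"] zero[of _ n] \<open>open \<Omega>\<close>
      unfolding W0_1_inf_def C01_def frontier_def by (simp add: interior_open) blast
    then have "\<bar>LINT x:\<Omega>|lebesgue. f x * \<psi> n x\<bar> \<le> ?S * (\<integral>x. norm (grad (\<psi> n) x) \<partial>lborel)"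
      by (intro weak_solution_test_bound[OF sol \<open>open \<Omega>\<close> a \<sigma> summable _ grad])
    also have "\<dots> \<le> ?S * P"
      using V[of n] P S by (intro mult_left_mono) auto
    finally show ?thesis .
  qed
  define d where "d n x = \<psi> n x - indicator E x" for n x
  have d: "integrable lborel (d n)" for n
  proof (rule integrableI_bounded)
    show "d n \<in> borel_measurable lborel" unfolding d_def by measurable
    show "(\<integral>\<^sup>+x. ennreal (norm (d n x)) \<partial>lborel) < \<infinity>"
      using le_less_trans[OF L1[of n] ennreal_less_top] by (simp add: d_def)
  qed
  have "(\<integral>x. norm (d n x) \<partial>lborel) \<le> e n" for n
  proof -
    have "ennreal (\<integral>x. norm (d n x) \<partial>lborel) \<le> ennreal (e n)"
      using L1[of n] nn_integral_eq_integral[OF integrable_norm[OF d[of n]]] by (simp add: d_def)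
    then show ?thesis using e[of n] by (simp add: ennreal_le_iff)
  qed
  then have "(\<lambda>n. \<integral>x. norm (d n x) \<partial>lborel) \<longlonglongrightarrow> 0"
    by (intro tendsto_sandwich[OF _ _ tendsto_const LIMSEQ_inverse_real_of_nat])
      (auto simp: e_def)
  from tendsto_L1_AE_subseq[OF d this] obtain s where s: "strict_mono s"
    "AE x in lborel. (\<lambda>n. d (s n) x) \<longlonglongrightarrow> 0" by blast
  have AE: "AE x in lebesgue. (\<lambda>n. \<psi> (s n) x) \<longlonglongrightarrow> indicator E x"
    using AE_completion[OF s(2)]
  proof eventually_elim
    case (elim x)
    from tendsto_add[OF elim tendsto_const[of "indicator E x"]] show ?case by (simp add: d_def)
  qed
  \<comment> \<open>\<open>f\<close> is controlled only on \<open>\<Omega>\<close>. Its extension by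
    zero is integrable on the whole space and dominates every
    \<open>F x * \<psi> (s n) x\<close>.\<close>
  define F where "F x = indicator \<Omega> x * f x" for x
  have F: "integrable lebesgue F"
    using f by (simp add: set_integrable_def F_def[abs_def])
  have \<psi>_meas: "\<psi> n \<in> borel_measurable lebesgue" for n
    by (rule measurable_completion) measurable
  have "(\<lambda>n. \<integral>x. F x * \<psi> (s n) x \<partial>lebesgue) \<longlonglongrightarrow> (\<integral>x. F x * indicator E x \<partial>lebesgue)"
  proof (rule integral_dominated_convergence)
    show "(\<lambda>x. F x * indicator E x) \<in> borel_measurable lebesgue"
      using E by (intro borel_measurable_times borel_measurable_integrable[OF F] borel_measurable_indicator) simp
    show "(\<lambda>x. F x * \<psi> (s n) x) \<in> borel_measurable lebesgue" for n
      by (intro borel_measurable_times borel_measurable_integrable[OF F] \<psi>_meas)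
    show "integrable lebesgue (\<lambda>x. norm (F x))" using F by (rule integrable_norm)
    show "AE x in lebesgue. (\<lambda>n. F x * \<psi> (s n) x) \<longlonglongrightarrow> F x * indicator E x"
      using AE by eventually_elim (rule tendsto_mult_left)
    show "AE x in lebesgue. norm (F x * \<psi> (s n) x) \<le> norm (F x)" for n
      using le1 by (intro AE_I2) (simp add: abs_mult mult_left_le)
  qed
  moreover have "(\<integral>x. F x * \<psi> n x \<partial>lebesgue) = (LINT x:\<Omega>|lebesgue. f x * \<psi> n x)" for n
    by (simp add: set_lebesgue_integral_def F_def mult.assoc)
  moreover have "(\<integral>x. F x * indicator E x \<partial>lebesgue) = (LINT x:E|lebesgue. f x)"
    unfolding set_lebesgue_integral_def
    using \<open>E \<subseteq> \<Omega>\<close> by (intro Bochner_Integration.integral_cong) (auto simp: F_def indicator_def)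
  ultimately have "(\<lambda>n. LINT x:\<Omega>|lebesgue. f x * \<psi> (s n) x) \<longlonglongrightarrow> (LINT x:E|lebesgue. f x)"
    by simp
  then have "\<bar>LINT x:E|lebesgue. f x\<bar> \<le> ?S * P"
    using bound by (intro LIMSEQ_le_const2[OF tendsto_rabs]) auto
  then have "ennreal \<bar>LINT x:E|lebesgue. f x\<bar> \<le> ennreal (?S * P)"
    by (rule ennreal_leI)
  also have "\<dots> = Lambda a \<sigma> * perimeter E"
    using ennreal_mult[OF S P(2)] by (simp only: Lambda_eq P(1))
  finally show ?thesis .
qed

theorem theorem5p1:
  fixes \<Omega> :: "'a::euclidean_space set"
    and a :: "nat \<Rightarrow> real" and \<sigma> :: real
    and f g u :: "'a \<Rightarrow> real"
  assumes "open \<Omega>" and "connected \<Omega>" and "bounded \<Omega>" and "lipschitz_boundary \<Omega>"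
    and "\<And>p. p \<ge> 2 \<Longrightarrow> a p \<ge> 0" and "a 2 > 0" and "infinite {p. p \<ge> 2 \<and> a p \<noteq> 0}"
    and "0 < \<sigma>" and "limsup (\<lambda>p. ereal (root p (a p))) = ereal (1 / \<sigma>)"
    and "Lambda a \<sigma> < \<infinity>"
    and "set_integrable lebesgue \<Omega> f"
    and "g \<in> C01 (frontier \<Omega>)"
    and "weak_solution \<Omega> a \<sigma> f g u"
  shows "\<forall>E. finite_perimeter E \<and> compactly_contained E \<Omega> \<longrightarrow>
           ennreal \<bar>LINT x:E|lebesgue. f x\<bar> \<le> Lambda a \<sigma> * perimeter E"
proof (intro allI impI, elim conjE)
  fix E assume fp: "finite_perimeter E" and cc: "compactly_contained E \<Omega>"
  obtain C T where CT: "C \<in> sets borel" "T \<in> null_sets lebesgue" "E = C \<union> T"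
    using fp lebesgue_set_borel_Un_null unfolding finite_perimeter_def by blast
  have C: "C \<in> sets lebesgue" using CT(1) by simp
  have per: "perimeter E = perimeter C"
    unfolding CT(3) by (rule perimeter_Un_null_set[OF C CT(2)])
  have "closure C \<subseteq> closure E" using CT(3) by (intro closure_mono) auto
  then have ccC: "compactly_contained C \<Omega>"
    using cc compact_Int_closed[of "closure E" "closure C"] by (auto simp: compactly_contained_def Int_absorb1)
  have sub: "C \<union> T \<subseteq> \<Omega>"
    using cc closure_subset[of E] unfolding CT(3) compactly_contained_def by blast
  \<comment> \<open>Again the extension by zero, now because dropping the null set \<open>T\<close>
    requires a function measurable on the whole space; \<open>E\<close> and \<open>C\<close> lie in
    \<open>\<Omega>\<close>, where it agrees with \<open>f\<close>.\<close>
  define F where "F x = indicator \<Omega> x * f x" for x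
  have "F \<in> borel_measurable lebesgue"
    using assms(11) by (auto simp: set_integrable_def F_def[abs_def])
  from set_integral_Un_null_set[OF this C CT(2)]
  have "(LINT x:C \<union> T|lebesgue. F x) = (LINT x:C|lebesgue. F x)" .
  moreover have "(LINT x:A|lebesgue. F x) = (LINT x:A|lebesgue. f x)" if "A \<subseteq> \<Omega>" for A
    unfolding set_lebesgue_integral_def
    using that by (intro Bochner_Integration.integral_cong) (auto simp: F_def indicator_def)
  ultimately have "(LINT x:E|lebesgue. f x) = (LINT x:C|lebesgue. f x)"
    using sub CT(3) by auto
  moreover have "ennreal \<bar>LINT x:C|lebesgue. f x\<bar> \<le> Lambda a \<sigma> * perimeter C"
    using assms(1,5,8,10,11,13) CT(1) ccC fp
    by (intro weak_solution_flux_bound_borel[where g = g and u = u]) (auto simp: finite_perimeter_def per)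
  ultimately show "ennreal \<bar>LINT x:E|lebesgue. f x\<bar> \<le> Lambda a \<sigma> * perimeter E"
    by (simp add: per)
qed

end
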